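(* Let $R=\mathbb C[x_1,\dots,x_n]$, let $A\in R^{\ell\times k}$ be a polynomial matrix and $S$ its syzygy matrix. Let $\mathcal F$ be an injective cogenerator, for instance $C^\infty(\mathbb R^n)$ or $\mathcal D'(\mathbb R^n)$. The following are equivalent: 1. $\ker_{\mathcal F}A$ is uncontrollable, i.e. $R^k/\operatorname{im}_R A^\top$ is torsion; 2. $\ker_R A=\{0\}$, i.e. $S=0$; 3. $\ker_{\mathbb C}A(\xi)=\{0\}$ for all $\xi\in\mathbb R^n$ outside a proper real algebraic subvariety of $\mathbb R^n$; 4. $\ker_{\mathbb C}A(\xi)=\{0\}$ for all $\xi\in\mathbb C^n$ outside a proper complex algebraic subvariety of $\mathbb C^n$. The proper variety in 3 (with $\mathbb F=\mathbb R$) and in 4 (with $\mathbb F=\mathbb C$) is $\{\xi\in\mathbb F^n:\operatorname{rank}A(\xi)\text{ is not maximal}\}$.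
   Context: Polynomial matrices are identified with constant-coefficient differential operators by letting $x_i$ act as $\partial_i$; functions and distributions are complex valued. $\ker_{\mathcal F}A=\{v\in\mathcal F^k:Av=0\}$. A syzygy matrix $S$ of $A$ is a matrix whose columns generate $\ker_R A\subseteq R^k$. An injective cogenerator is an $R$-module $\mathcal F$ such that $\operatorname{Hom}_R(\cdot,\mathcal F)$ is exact and $\operatorname{Hom}_R(M,\mathcal F)\neq0$ for every nonzero $R$-module $M$. A module $U$ is torsion if for every $u\in U$ there is a nonzero $r\in R$ with $ru=0$. The rank of $A(\xi)$ is maximal if it equals the generic rank, i.e. the maximum of $\operatorname{rank}_{\mathbb C}A(\eta)$ over $\eta\in\mathbb C^n$ (equivalently, the largest size of a nonzero minor of $A$). *)

theory Defs
  imports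
    "HOL-Algebra.AbelCoset"
    "Jordan_Normal_Form.DL_Rank"
    "Jordan_Normal_Form.Matrix_Kernel"
    "HOL-Library.Poly_Mapping"
begin

section \<open>Polynomials, algebraic subvarieties, rank\<close>

text \<open>Polynomials over \<open>'a\<close> in the variables \<open>x\<^sub>i\<close>, \<open>i :: 'n\<close>, as finitely supported functions
  from exponent vectors to coefficients (the library product is convolution). The points of
  affine space are the functions \<open>'n \<Rightarrow> 'a\<close>; the number of variables is \<open>CARD('n)\<close>.\<close>

type_synonym ('n, 'a) mpoly = "('n \<Rightarrow>\<^sub>0 nat) \<Rightarrow>\<^sub>0 'a"

definition mpoly_eval :: "('n::finite, 'a::comm_ring_1) mpoly \<Rightarrow> ('n \<Rightarrow> 'a) \<Rightarrow> 'a" where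
  "mpoly_eval p \<xi> = (\<Sum>m\<in>Poly_Mapping.keys p.
       Poly_Mapping.lookup p m * (\<Prod>i\<in>UNIV. \<xi> i ^ Poly_Mapping.lookup m i))"

definition mat_at :: "('n::finite, 'a::comm_ring_1) mpoly mat \<Rightarrow> ('n \<Rightarrow> 'a) \<Rightarrow> 'a mat" where
  "mat_at A \<xi> = map_mat (\<lambda>p. mpoly_eval p \<xi>) A"

definition algebraic_subvariety :: "('n::finite \<Rightarrow> 'a::field) set \<Rightarrow> bool" where
  "algebraic_subvariety V \<longleftrightarrow>
     (\<exists>P :: ('n, 'a) mpoly set. V = {\<xi>. \<forall>p\<in>P. mpoly_eval p \<xi> = 0})"

definition proper_subvariety :: "('n::finite \<Rightarrow> 'a::field) set \<Rightarrow> bool" where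
  "proper_subvariety V \<longleftrightarrow> algebraic_subvariety V \<and> V \<noteq> UNIV"

abbreviation mat_rank :: "'a::field mat \<Rightarrow> nat" where
  "mat_rank B \<equiv> vec_space.rank (dim_row B) B"

definition generic_rank :: "('n::finite, complex) mpoly mat \<Rightarrow> nat" where
  "generic_rank A = Max (range (\<lambda>\<eta>. mat_rank (mat_at A \<eta>)))"

abbreviation real_point :: "('n \<Rightarrow> real) \<Rightarrow> 'n \<Rightarrow> complex" where
  "real_point \<xi> \<equiv> (\<lambda>i. complex_of_real (\<xi> i))"

definition real_rank_drop :: "('n::finite, complex) mpoly mat \<Rightarrow> ('n \<Rightarrow> real) set" where
  "real_rank_drop A = {\<xi>. mat_rank (mat_at A (real_point \<xi>)) \<noteq> generic_rank A}"

definition complex_rank_drop :: "('n::finite, complex) mpoly mat \<Rightarrow> ('n \<Rightarrow> complex) set" where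
  "complex_rank_drop A = {\<xi>. mat_rank (mat_at A \<xi>) \<noteq> generic_rank A}"


section \<open>Modules\<close>

text \<open>\<open>class_ring\<close> is the ring structure of a type of class \<open>comm_ring_1\<close>, and
  \<open>module_vec TYPE('r) k\<close> is the free module of rank \<open>k\<close> over it.\<close>

abbreviation is_module :: "('r::comm_ring_1, 'm, 'c) module_scheme \<Rightarrow> bool" where
  "is_module \<equiv> Module.module class_ring"

abbreviation Hom ::
  "('r::comm_ring_1, 'm, 'c) module_scheme \<Rightarrow> ('r, 'f, 'd) module_scheme \<Rightarrow> ('m \<Rightarrow> 'f) set" where
  "Hom \<equiv> LinearCombinations.module_hom class_ring"

definition torsion_module :: "('r::comm_ring_1, 'm, 'c) module_scheme \<Rightarrow> bool" where
  "torsion_module U \<longleftrightarrow> (\<forall>u\<in>carrier U. \<exists>r. r \<noteq> 0 \<and> r \<odot>\<^bsub>U\<^esub> u = \<zero>\<^bsub>U\<^esub>)"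

definition quotient_module ::
  "('r, 'm, 'c) module_scheme \<Rightarrow> 'm set \<Rightarrow> ('r, 'm set) module" where
  "quotient_module M N =
     \<lparr>carrier = a_rcosets\<^bsub>M\<^esub> N, mult = undefined, one = undefined,
      zero = N, add = set_add M,
      smult = (\<lambda>r X. \<Union>x\<in>X. N +>\<^bsub>M\<^esub> (r \<odot>\<^bsub>M\<^esub> x))\<rparr>"

text \<open>HOL cannot quantify over the modules of all types, so the test modules \<open>M\<close> below range over
  the modules whose carrier is a set of sets of vectors over the ring. Up to isomorphism these
  include every finitely generated module (as cosets in a free module) and every ideal (as
  singletons). By Baer's criterion, and because every nonzero module has a nonzero cyclic submodule, the
  definitions are therefore equivalent to the ones with arbitrary modules \<open>M\<close>.\<close>

type_synonym 'r test_module = "('r, 'r vec set) module"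

text \<open>Exactness of \<open>Hom(\<cdot>, F)\<close>: it takes exact sequences \<open>M1 \<rightarrow> M2 \<rightarrow> M3\<close> to exact sequences
  \<open>Hom(M3, F) \<rightarrow> Hom(M2, F) \<rightarrow> Hom(M1, F)\<close>. Elements of \<open>Hom M N\<close> are unspecified
  outside the carrier, so they are compared on the carrier only.\<close>

definition hom_into_exact :: "('r::comm_ring_1, 'f, 'c) module_scheme \<Rightarrow> bool" where
  "hom_into_exact F \<longleftrightarrow>
     (\<forall>(M1 :: 'r test_module) (M2 :: 'r test_module) (M3 :: 'r test_module) f g.
        is_module M1 \<and> is_module M2 \<and> is_module M3 \<and>
        f \<in> Hom M1 M2 \<and> g \<in> Hom M2 M3 \<and>
        f ` carrier M1 = {x \<in> carrier M2. g x = \<zero>\<^bsub>M3\<^esub>} \<longrightarrow>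
        (\<forall>h\<in>Hom M2 F.
           (\<forall>x\<in>carrier M1. h (f x) = \<zero>\<^bsub>F\<^esub>) \<longleftrightarrow>
           (\<exists>h'\<in>Hom M3 F. \<forall>x\<in>carrier M2. h x = h' (g x))))"

definition injective_cogenerator :: "('r::comm_ring_1, 'f, 'c) module_scheme \<Rightarrow> bool" where
  "injective_cogenerator F \<longleftrightarrow>
     is_module F \<and> hom_into_exact F \<and>
     (\<forall>M :: 'r test_module.
        is_module M \<and> carrier M \<noteq> {\<zero>\<^bsub>M\<^esub>} \<longrightarrow>
        (\<exists>h\<in>Hom M F. \<exists>x\<in>carrier M. h x \<noteq> \<zero>\<^bsub>F\<^esub>))"


section \<open>Kernels, syzygies and controllability\<close>

definition mat_image :: "'r::comm_ring_1 mat \<Rightarrow> 'r vec set" where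
  "mat_image B = (\<lambda>w. B *\<^sub>v w) ` carrier_vec (dim_col B)"

definition coker_transpose :: "'r::comm_ring_1 mat \<Rightarrow> ('r, 'r vec set) module" where
  "coker_transpose A = quotient_module (module_vec TYPE('r) (dim_col A)) (mat_image A\<^sup>T)"

text \<open>The library's \<open>mat_kernel\<close> is the kernel on vectors over the coefficient ring itself;
  \<open>module_kernel F A\<close> is the kernel of \<open>A\<close> on vectors with entries in the module \<open>F\<close>.\<close>

definition module_kernel ::
  "('r::comm_ring_1, 'f, 'c) module_scheme \<Rightarrow> 'r mat \<Rightarrow> 'f vec set" where
  "module_kernel F A =
     {v \<in> carrier_vec (dim_col A).
        (\<forall>j<dim_col A. v $ j \<in> carrier F) \<and>
        (\<forall>i<dim_row A. (\<Oplus>\<^bsub>F\<^esub>j\<in>{..<dim_col A}. A $$ (i, j) \<odot>\<^bsub>F\<^esub> v $ j) = \<zero>\<^bsub>F\<^esub>)}"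

definition syzygy_matrix :: "'r::comm_ring_1 mat \<Rightarrow> 'r mat \<Rightarrow> bool" where
  "syzygy_matrix A S \<longleftrightarrow>
     dim_row S = dim_col A \<and>
     LinearCombinations.module.span class_ring (module_vec TYPE('r) (dim_col A)) (set (cols S)) = mat_kernel A"

text \<open>Uncontrollability is a property of the solution set, expressed through a matrix presenting it.
  For an injective cogenerator \<open>F\<close> the solution set determines the submodule generated by the
  rows of the matrix, so the choice of \<open>A\<close> is immaterial.\<close>

definition uncontrollable ::
  "('r::comm_ring_1, 'f, 'c) module_scheme \<Rightarrow> 'f vec set \<Rightarrow> bool" where
  "uncontrollable F B \<longleftrightarrow> (\<exists>A. B = module_kernel F A \<and> torsion_module (coker_transpose A))"

end

theory Submission imports Defs
begin

text \<open>
  Everything is read off from the nonzero minors of \<open>A\<close>. Let \<open>r\<close> be the largest size of a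
  nonzero minor, \<open>k\<close> the number of columns.

  If \<open>r < k\<close>, expanding minors of size \<open>r + 1\<close> along a row gives a vector of minors of size \<open>r\<close>
  which is a nonzero element of \<open>ker A\<close>; this works over every commutative ring
  (\<open>kernel_zero_imp_has_minor\<close>). If \<open>r = k\<close>, the adjugate of the submatrix belonging to a
  nonzero minor \<open>d\<close> gives \<open>Z\<close> with \<open>Z A = d\<cdot>1\<close> (\<open>full_minor_left_inverse\<close>). The identity
  \<open>Z A = d\<cdot>1\<close> says that \<open>A\<close> is injective, when the ring is a domain, and its transpose
  \<open>A\<^sup>T Z\<^sup>T = d\<cdot>1\<close> says that \<open>d\<close> annihilates the cokernel of \<open>A\<^sup>T\<close>. Conversely, if \<open>a e\<^sub>j = A\<^sup>T z\<close>
  with \<open>a \<noteq> 0\<close>, then every \<open>w\<close> in \<open>ker A\<close> has \<open>a w\<^sub>j = z \<bullet> A w = 0\<close>. So the cokernel is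
  torsion exactly if \<open>ker A = 0\<close>, exactly if \<open>A\<close> has a nonzero minor of size \<open>k\<close>.

  The same lemma over a field identifies the rank with the largest size of a nonzero minor
  (\<open>has_minor_iff_le_rank\<close>). As evaluation at a point is a ring homomorphism, the minors of
  \<open>A(\<xi>)\<close> are the values of the minors of \<open>A\<close>, and a nonzero polynomial has a nonzero value
  at some point, even a real one (\<open>common_real_nonroot\<close>, by Kronecker substitution). Hence the generic rank is the
  largest size of a nonzero minor of \<open>A\<close>, the rank drops exactly on the common zeros of the minors of
  that size, and this set is proper in real as well as in complex space.

  The injective cogenerator enters only where the solution set is concerned. It yields
  homomorphisms into \<open>F\<close> separating the points of every test module, so every vector
  outside the row module of a matrix is detected by some solution of the system
  (\<open>solution_outside_row_module\<close>). Therefore the solution set determines the row module, and with it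
  the cokernel, so that being uncontrollable does not depend on the matrix that presents the solution set.
\<close>

section \<open>Minors, kernels and rank\<close>

text \<open>Rows and columns are selected by functions that need be neither injective nor
  monotone; a repetition only gives a zero minor. Thus a minor is enlarged or restricted without
  any renumbering.\<close>

definition minor :: "'a::comm_ring_1 mat \<Rightarrow> nat \<Rightarrow> (nat \<Rightarrow> nat) \<Rightarrow> (nat \<Rightarrow> nat) \<Rightarrow> 'a" where
  "minor B r f g = det (mat r r (\<lambda>(i, j). B $$ (f i, g j)))"

definition has_minor :: "'a::comm_ring_1 mat \<Rightarrow> nat \<Rightarrow> bool" where
  "has_minor B r \<longleftrightarrow> (\<exists>f g. (\<forall>i<r. f i < dim_row B) \<and> (\<forall>j<r. g j < dim_col B) \<and> minor B r f g \<noteq> 0)"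

definition minors :: "'a::comm_ring_1 mat \<Rightarrow> nat \<Rightarrow> 'a set" where
  "minors B r = {minor B r f g | f g. (\<forall>i<r. f i < dim_row B) \<and> (\<forall>j<r. g j < dim_col B)}"

lemma has_minor_iff_minors: "has_minor B r \<longleftrightarrow> (\<exists>d\<in>minors B r. d \<noteq> 0)"
  unfolding has_minor_def minors_def by blast

lemma has_minor_0: "has_minor B 0"
proof -
  have "minor B 0 id id = 1" by (simp add: minor_def det_dim_zero)
  then show ?thesis unfolding has_minor_def by (intro exI[of _ id]) simp
qed

text \<open>If all \<open>k\<close> columns are available, a selection of \<open>k\<close> of them is multiplication by a square matrix
  from the right, so a nonzero minor stays nonzero when the columns are put in their natural order.\<close>

lemma minor_all_columns:
  assumes g: "\<And>j. j < k \<Longrightarrow> g j < k" and nz: "minor B k f g \<noteq> 0"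
  shows "minor B k f id \<noteq> 0"
proof
  assume 0: "minor B k f id = 0"
  let ?C = "mat k k (\<lambda>(i, j). B $$ (f i, j))"
  let ?E = "mat k k (\<lambda>(a, j). if a = g j then 1 else 0)"
  have "mat k k (\<lambda>(i, j). B $$ (f i, g j)) = ?C * ?E"
    by (rule eq_matI) (auto simp: scalar_prod_def g sum.delta if_distrib[of "\<lambda>x. _ * x"] cong: if_cong)
  then have "minor B k f g = det (?C * ?E)"
    by (simp add: minor_def)
  also have "\<dots> = det ?C * det ?E"
    by (rule det_mult) auto
  also have "det ?C = 0" using 0 by (simp add: minor_def)
  finally show False using nz by simp
qed

lemma has_minor_le_dim_col:
  assumes "has_minor B r"
  shows "r \<le> dim_col B"
proof (rule ccontr)
  assume "\<not> r \<le> dim_col B"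
  then have less: "dim_col B < r" by simp
  obtain f g where g: "\<forall>j<r. g j < dim_col B" and nz: "minor B r f g \<noteq> 0"
    using assms by (auto simp: has_minor_def)
  have "\<not> inj_on g {..<r}"
  proof
    assume "inj_on g {..<r}"
    then have "card {..<r} \<le> card {..<dim_col B}"
      by (rule card_inj_on_le) (use g in auto)
    then show False using less by simp
  qed
  then obtain a b where ab: "a < r" "b < r" "a \<noteq> b" "g a = g b"
    by (auto simp: inj_on_def)
  have "det (mat r r (\<lambda>(i, j). B $$ (f i, g j))) = 0"
    by (rule det_identical_columns[of _ r a b]) (use ab in \<open>auto intro!: eq_vecI\<close>)
  then show False using nz by (simp add: minor_def)
qed

text \<open>The contrapositive is a version of a theorem of McCoy. Take a nonzero minor of maximal size
  \<open>r\<close> and suppose that some column \<open>c\<close> is not used. The signed minors that belong to the \<open>r\<close> rows of the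
  minor and to \<open>r\<close> of the \<open>r + 1\<close> columns are the coefficients of a linear relation between these
  columns: applied to row \<open>i\<close> of the matrix they give, by Laplace expansion, a minor of size \<open>r + 1\<close>, which is zero.
  The coefficient of \<open>c\<close> is the original minor, so the relation is not trivial.\<close>

lemma kernel_zero_imp_has_minor:
  assumes ker: "mat_kernel B = {0\<^sub>v (dim_col B)}"
  shows "has_minor B (dim_col B)"
proof -
  let ?k = "dim_col B" and ?l = "dim_row B"
  define r where "r = (GREATEST r. has_minor B r)"
  have bound: "y \<le> ?k" if "has_minor B y" for y using that by (rule has_minor_le_dim_col)
  have r: "has_minor B r" unfolding r_def by (rule GreatestI_nat[of "has_minor B" 0 ?k]) (use has_minor_0 bound in auto)
  have max: "\<not> has_minor B (Suc r)"
    using Greatest_le_nat[of "has_minor B" "Suc r", OF _ bound] unfolding r_def by auto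
  have "\<not> r < ?k"
  proof
    assume rk: "r < ?k"
    obtain f g where f: "\<forall>i<r. f i < ?l" and g: "\<forall>j<r. g j < ?k" and nz: "minor B r f g \<noteq> 0"
      using r by (auto simp: has_minor_def)
    have "\<exists>c<?k. c \<notin> g ` {..<r}"
    proof (rule ccontr)
      assume "\<not> ?thesis"
      then have "{..<?k} \<subseteq> g ` {..<r}" by auto
      then have "card {..<?k} \<le> card (g ` {..<r})" by (intro card_mono) auto
      also have "\<dots> \<le> card {..<r}" by (rule card_image_le) simp
      finally show False using rk by simp
    qed
    then obtain c where c: "c < ?k" "c \<notin> g ` {..<r}" by auto
    define g' where "g' j = (if j = r then c else g j)" for j
    define M where "M i = mat (Suc r) (Suc r) (\<lambda>(a, j). B $$ (if a = r then i else f a, g' j))" for i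
    \<comment> \<open>The cofactors along the last row do not involve that row, so they are the same for every \<open>i\<close>.\<close>
    define cof where "cof j = cofactor (M 0) r j" for j
    have cof: "cofactor (M i) r j = cof j" if "j < Suc r" for i j
      unfolding cof_def cofactor_def mat_delete_def M_def
      by (intro arg_cong2[of _ _ _ _ "(*)"] arg_cong[of _ _ det] eq_matI) (use that in auto)
    have det0: "det (M i) = 0" if "i < ?l" for i
    proof (rule ccontr)
      assume "det (M i) \<noteq> 0"
      then have "minor B (Suc r) (\<lambda>a. if a = r then i else f a) g' \<noteq> 0"
        by (simp add: minor_def M_def)
      moreover have "\<forall>a<Suc r. (if a = r then i else f a) < ?l" using f that by (auto simp: less_Suc_eq)
      moreover have "\<forall>j<Suc r. g' j < ?k" using g c by (auto simp: g'_def less_Suc_eq)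
      ultimately have "has_minor B (Suc r)"
        unfolding has_minor_def by (intro exI conjI)
      then show False using max by contradiction
    qed
    \<comment> \<open>The sum adds up the coefficients of equal columns, as \<open>g'\<close> is not known to be injective.\<close>
    define w where "w = vec ?k (\<lambda>a. \<Sum>j<Suc r. if g' j = a then cof j else 0)"
    have g'k: "g' j < ?k" if "j < Suc r" for j
      using that g c by (auto simp: g'_def less_Suc_eq)
    have Bw: "B *\<^sub>v w = 0\<^sub>v ?l"
    proof (rule eq_vecI)
      fix i assume "i < dim_vec (0\<^sub>v ?l :: 'a vec)"
      then have i: "i < ?l" by simp
      have "(B *\<^sub>v w) $ i = (\<Sum>a<?k. B $$ (i, a) * (\<Sum>j<Suc r. if g' j = a then cof j else 0))"
        using i by (simp add: w_def scalar_prod_def lessThan_atLeast0)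
      also have "\<dots> = (\<Sum>j<Suc r. \<Sum>a<?k. if g' j = a then B $$ (i, a) * cof j else 0)"
        unfolding sum_distrib_left
        by (subst sum.swap) (intro sum.cong refl, auto)
      also have "\<dots> = (\<Sum>j<Suc r. B $$ (i, g' j) * cof j)"
        by (intro sum.cong refl) (use g'k in \<open>auto simp: sum.delta'\<close>)
      also have "\<dots> = (\<Sum>j<Suc r. M i $$ (r, j) * cofactor (M i) r j)"
        by (intro sum.cong refl) (use cof in \<open>auto simp: M_def\<close>)
      also have "\<dots> = det (M i)"
        by (rule laplace_expansion_row[symmetric]) (auto simp: M_def)
      finally show "(B *\<^sub>v w) $ i = 0\<^sub>v ?l $ i" using det0[OF i] i by simp
    qed simp
    have "w $ c = (\<Sum>j<Suc r. if j = r then cof r else 0)"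
    proof -
      have "(\<Sum>j<Suc r. if g' j = c then cof j else 0) = (\<Sum>j<Suc r. if j = r then cof r else 0)"
        by (intro sum.cong refl) (use c in \<open>auto simp: g'_def\<close>)
      then show ?thesis using c by (simp add: w_def)
    qed
    also have "\<dots> = cof r" by simp
    also have "cof r = minor B r f g"
      unfolding cof_def cofactor_def minor_def mat_delete_def M_def
      by (auto intro!: arg_cong[of _ _ det] eq_matI simp: g'_def)
    finally have "w $ c \<noteq> 0" using nz by simp
    moreover have "w \<in> mat_kernel B"
      using Bw by (simp add: mat_kernel_def w_def)
    ultimately show False using ker c by auto
  qed
  moreover have "r \<le> ?k" using r by (rule has_minor_le_dim_col)
  ultimately show ?thesis using r by simp
qed

text \<open>\<open>Z\<close> is the adjugate of the \<open>k \<times> k\<close> submatrix, composed with the selection of its rows.\<close>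

lemma full_minor_left_inverse:
  assumes B: "B \<in> carrier_mat l k" and minor: "has_minor B k"
  obtains Z d where "Z \<in> carrier_mat k l" "d \<noteq> 0" "Z * B = d \<cdot>\<^sub>m 1\<^sub>m k"
proof -
  obtain f g where f: "\<forall>i<k. f i < l" and g: "\<forall>j<k. g j < k" and nz: "minor B k f g \<noteq> 0"
    using minor B by (auto simp: has_minor_def)
  have nz': "minor B k f id \<noteq> 0" using minor_all_columns[OF _ nz] g by auto
  define C where "C = mat k k (\<lambda>(i, j). B $$ (f i, j))"
  define T where "T = mat k l (\<lambda>(i, a). if a = f i then 1 else 0 :: 'a)"
  have C: "C \<in> carrier_mat k k" and T: "T \<in> carrier_mat k l" by (auto simp: C_def T_def)
  have TB: "T * B = C"
    by (rule eq_matI)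
      (use B f in \<open>auto simp: C_def T_def scalar_prod_def sum.delta if_distrib[of "\<lambda>x. x * _"] cong: if_cong\<close>)
  have "adj_mat C * T * B = det C \<cdot>\<^sub>m 1\<^sub>m k"
    using adj_mat[OF C] T B TB by (simp add: assoc_mult_mat[of _ k k _ l _ k])
  moreover have "det C \<noteq> 0" using nz' by (simp add: minor_def C_def)
  moreover have "adj_mat C * T \<in> carrier_mat k l" using adj_mat[OF C] T by auto
  ultimately show ?thesis using that by blast
qed

text \<open>Absence of zero divisors is a hypothesis instead of a class constraint because the polynomials
  in variables from an unordered type are not an instance of the class \<^class>\<open>idom\<close>.\<close>

lemma kernel_zero_iff_has_minor:
  fixes B :: "'a::comm_ring_1 mat"
  assumes B: "B \<in> carrier_mat l k"
    and integral: "\<And>a b :: 'a. a * b = 0 \<Longrightarrow> a = 0 \<or> b = 0"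
  shows "mat_kernel B = {0\<^sub>v k} \<longleftrightarrow> has_minor B k"
proof
  assume "mat_kernel B = {0\<^sub>v k}"
  then show "has_minor B k" using kernel_zero_imp_has_minor[of B] B by auto
next
  assume "has_minor B k"
  then obtain Z d where Z: "Z \<in> carrier_mat k l" and d: "d \<noteq> 0" and ZB: "Z * B = d \<cdot>\<^sub>m 1\<^sub>m k"
    using full_minor_left_inverse[OF B] by blast
  have "w = 0\<^sub>v k" if w: "w \<in> mat_kernel B" for w
  proof -
    have wk: "w \<in> carrier_vec k" and Bw: "B *\<^sub>v w = 0\<^sub>v l" using mat_kernelD[OF B w] by auto
    have "d \<cdot>\<^sub>v w = (d \<cdot>\<^sub>m 1\<^sub>m k) *\<^sub>v w" using wk by auto
    also have "\<dots> = Z *\<^sub>v (B *\<^sub>v w)"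
      unfolding ZB[symmetric] by (rule assoc_mult_mat_vec[OF Z B wk])
    also have "\<dots> = 0\<^sub>v k" using Bw Z by auto
    finally have dw: "d \<cdot>\<^sub>v w = 0\<^sub>v k" .
    show ?thesis
    proof (rule eq_vecI)
      fix i assume "i < dim_vec (0\<^sub>v k :: 'a vec)"
      then have i: "i < k" by simp
      then have "d * w $ i = 0" using arg_cong[OF dw, of "\<lambda>v. v $ i"] wk by simp
      then show "w $ i = 0\<^sub>v k $ i" using integral d i by auto
    qed (use wk in simp)
  qed
  moreover have "0\<^sub>v k \<in> mat_kernel B" using B by (auto simp: mat_kernel_def)
  ultimately show "mat_kernel B = {0\<^sub>v k}" by blast
qed

lemma has_minor_select_columns:
  assumes "has_minor (mat (dim_row B) r (\<lambda>(i, j). B $$ (i, g j))) r" and g: "\<forall>j<r. g j < dim_col B"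
  shows "has_minor B r"
proof -
  let ?D = "mat (dim_row B) r (\<lambda>(i, j). B $$ (i, g j))"
  obtain f h where f: "\<forall>i<r. f i < dim_row B" and h: "\<forall>j<r. h j < r" and nz: "minor ?D r f h \<noteq> 0"
    using assms(1) by (auto simp: has_minor_def)
  have "minor ?D r f h = minor B r f (g \<circ> h)"
    unfolding minor_def using f h by (auto intro!: arg_cong[of _ _ det])
  then have "minor B r f (g \<circ> h) \<noteq> 0" using nz by simp
  moreover have "\<forall>j<r. (g \<circ> h) j < dim_col B" using g h by simp
  ultimately show ?thesis using f unfolding has_minor_def by blast
qed

lemma mat_mult_unit_vec:
  fixes B :: "'a::comm_ring_1 mat"
  assumes "B \<in> carrier_mat l k" "j < k"
  shows "B *\<^sub>v unit_vec k j = col B j"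
proof (rule eq_vecI)
  fix i assume "i < dim_vec (col B j)"
  then show "(B *\<^sub>v unit_vec k j) $ i = col B j $ i"
    using assms scalar_prod_right_unit[of j k "row B i"] by auto
qed (use assms in auto)

text \<open>Columns of a matrix over a field are distinct and independent exactly if the matrix that they form
  has zero kernel, and this has just been expressed by minors.\<close>

lemma has_minor_iff_le_rank:
  fixes B :: "'a::field mat"
  shows "has_minor B r \<longleftrightarrow> r \<le> mat_rank B"
proof -
  let ?n = "dim_row B"
  interpret vec_space "TYPE('a)" ?n .
  have B: "B \<in> carrier_mat ?n (dim_col B)" by simp
  show ?thesis
  proof
    assume "has_minor B r"
    then obtain f g where f: "\<forall>i<r. f i < ?n" and g: "\<forall>j<r. g j < dim_col B"
      and nz: "minor B r f g \<noteq> 0"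
      by (auto simp: has_minor_def)
    define D where "D = mat ?n r (\<lambda>(i, j). B $$ (i, g j))"
    have D: "D \<in> carrier_mat ?n r" by (simp add: D_def)
    have colD: "col D j = col B (g j)" if "j < r" for j
      using that g by (auto simp: D_def)
    have "minor D r f id = minor B r f g"
      unfolding minor_def D_def using f by (auto intro!: arg_cong[of _ _ det] eq_matI)
    then have "has_minor D r"
      unfolding has_minor_def using f nz D by (intro exI[of _ f] exI[of _ id]) auto
    then have ker: "mat_kernel D = {0\<^sub>v r}" using kernel_zero_iff_has_minor[OF D] by auto
    have dist: "distinct (cols D)"
    proof (rule ccontr)
      assume "\<not> distinct (cols D)"
      then obtain a b where ab: "a < r" "b < r" "a \<noteq> b" "col D a = col D b"
        using D by (auto simp: distinct_conv_nth)
      let ?w = "unit_vec r a - unit_vec r b :: 'a vec"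
      have "D *\<^sub>v ?w = D *\<^sub>v unit_vec r a - D *\<^sub>v unit_vec r b"
        by (rule mult_minus_distrib_mat_vec[OF D]) auto
      also have "\<dots> = 0\<^sub>v ?n"
        using ab D by (simp add: mat_mult_unit_vec[OF D])
      finally have "?w \<in> mat_kernel D" using D by (auto simp: mat_kernel_def)
      then have "?w = 0\<^sub>v r" using ker by simp
      then have "?w $ a = 0" using ab by simp
      then show False using ab by simp
    qed
    have indpt: "lin_indpt (set (cols D))"
    proof
      assume "lin_dep (set (cols D))"
      then obtain v where "v \<in> carrier_vec r" "v \<noteq> 0\<^sub>v r" "D *\<^sub>v v = 0\<^sub>v ?n"
        using lin_depE[OF D _ dist] by blast
      then show False using ker mat_kernelI[OF D] by auto
    qed
    have "set (cols D) \<subseteq> set (cols B)"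
      using D g colD by (auto simp: cols_def)
    from rank_ge_card_indpt[OF B this indpt]
    show "r \<le> rank B" using distinct_card[OF dist] D by simp
  next
    assume r: "r \<le> rank B"
    obtain U where U: "maximal U (\<lambda>T. T \<subseteq> set (cols B) \<and> lin_indpt T)"
    proof -
      have "lin_indpt {}" by (auto simp: lin_dep_def)
      then show ?thesis
        using maximal_exists_superset[of "set (cols B)" "\<lambda>T. T \<subseteq> set (cols B) \<and> lin_indpt T" "{}"] that
        by auto
    qed
    have "rank B = card U" by (rule rank_card_indpt[OF B U])
    moreover have Ucols: "U \<subseteq> set (cols B)" and Uind: "lin_indpt U"
      using U by (auto simp: maximal_def)
    ultimately obtain W where W: "W \<subseteq> U" "card W = r" "finite W"
      using r obtain_subset_with_card_n by metis
    obtain ws where ws: "set ws = W" "distinct ws"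
      using W finite_distinct_list by metis
    have len: "length ws = r" using ws W distinct_card by fastforce
    have "\<forall>j<r. \<exists>c<dim_col B. ws ! j = col B c"
    proof (intro allI impI)
      fix j assume "j < r"
      then have "ws ! j \<in> W" using ws(1) len nth_mem[of j ws] by simp
      then have "ws ! j \<in> set (cols B)" using W(1) Ucols by (meson subsetD)
      then show "\<exists>c<dim_col B. ws ! j = col B c" by (auto simp: cols_def)
    qed
    then obtain g where g: "\<forall>j<r. g j < dim_col B \<and> ws ! j = col B (g j)" by metis
    define D where "D = mat ?n r (\<lambda>(i, j). B $$ (i, g j))"
    have D: "D \<in> carrier_mat ?n r" by (simp add: D_def)
    have cols: "cols D = ws"
      using g len by (intro nth_equalityI) (auto simp: D_def)
    have "mat_kernel D = {0\<^sub>v r}"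
    proof -
      have "lin_indpt W"
        by (rule subset_li_is_li[OF Uind W(1)])
      then have "v = 0\<^sub>v r" if "v \<in> mat_kernel D" for v
        using lin_depI[OF D mat_kernelD(1)[OF D that] _ mat_kernelD(2)[OF D that]] cols ws by auto
      then show ?thesis using D by (auto simp: mat_kernel_def)
    qed
    then have "has_minor D r" using kernel_zero_iff_has_minor[OF D] by auto
    then show "has_minor B r" unfolding D_def by (rule has_minor_select_columns) (use g in auto)
  qed
qed

section \<open>Evaluation of polynomials\<close>

lemma mpoly_eval_superset:
  assumes "finite S" "Poly_Mapping.keys p \<subseteq> S"
  shows "mpoly_eval p \<xi> = (\<Sum>m\<in>S. Poly_Mapping.lookup p m * (\<Prod>i\<in>UNIV. \<xi> i ^ Poly_Mapping.lookup m i))"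
  unfolding mpoly_eval_def
  by (rule sum.mono_neutral_left) (use assms in \<open>auto simp: in_keys_iff\<close>)

lemma mpoly_eval_zero [simp]: "mpoly_eval 0 \<xi> = 0"
  by (simp add: mpoly_eval_def)

lemma mpoly_eval_single:
  "mpoly_eval (Poly_Mapping.single m c) \<xi> = c * (\<Prod>i\<in>UNIV. \<xi> i ^ Poly_Mapping.lookup m i)"
  by (subst mpoly_eval_superset[of "{m}"]) auto

lemma mpoly_eval_one [simp]: "mpoly_eval 1 \<xi> = 1"
  by (simp add: mpoly_eval_single flip: single_one)

lemma mpoly_eval_add: "mpoly_eval (p + q) \<xi> = mpoly_eval p \<xi> + mpoly_eval q \<xi>"
  using keys_add[of p q]
  by (simp add: mpoly_eval_superset[of "Poly_Mapping.keys p \<union> Poly_Mapping.keys q"]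
      lookup_add distrib_right sum.distrib)

lemma mpoly_additive_induct [case_names zero single add]:
  assumes "P 0" "\<And>m c. P (Poly_Mapping.single m c)" "\<And>p q. P p \<Longrightarrow> P q \<Longrightarrow> P (p + q)"
  shows "P p"
proof (induction p rule: update_induct)
  case const
  then show ?case by (rule assms)
next
  case (update p m c)
  have "Poly_Mapping.update m c p = p + Poly_Mapping.single m c"
    using update(1)
    by (intro poly_mapping_eqI) (auto simp: lookup_update lookup_add lookup_single in_keys_iff)
  then show ?case using assms update by simp
qed

lemma mpoly_eval_mult: "mpoly_eval (p * q) \<xi> = mpoly_eval p \<xi> * mpoly_eval q \<xi>"
proof (induction p rule: mpoly_additive_induct)
  case (single m c)
  show ?case
  proof (induction q rule: mpoly_additive_induct)
    case (single n d)
    show ?case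
      by (simp add: mult_single mpoly_eval_single lookup_add power_add prod.distrib algebra_simps)
  qed (auto simp: distrib_left mpoly_eval_add)
qed (auto simp: distrib_right mpoly_eval_add)

interpretation mpoly_eval: comm_ring_hom "\<lambda>p. mpoly_eval p \<xi>"
  by unfold_locales (auto simp: mpoly_eval_add mpoly_eval_mult)

text \<open>Uniqueness of digits in base \<open>d\<close>, which makes Kronecker substitution injective on monomials of
  bounded exponents.\<close>

lemma base_expansion_unique:
  fixes a b :: "nat \<Rightarrow> nat"
  assumes "\<And>i. i < N \<Longrightarrow> a i < d" "\<And>i. i < N \<Longrightarrow> b i < d"
    and "(\<Sum>i<N. a i * d ^ i) = (\<Sum>i<N. b i * d ^ i)" and "i < N"
  shows "a i = b i"
  using assms
proof (induction N arbitrary: a b i)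
  case (Suc N)
  have split: "(\<Sum>i<Suc N. c i * d ^ i) = c 0 + d * (\<Sum>i<N. c (Suc i) * d ^ i)" for c
    by (subst sum.lessThan_Suc_shift) (simp add: sum_distrib_left algebra_simps)
  have less: "a 0 < d" "b 0 < d" using Suc.prems by auto
  have eq: "a 0 + d * (\<Sum>i<N. a (Suc i) * d ^ i) = b 0 + d * (\<Sum>i<N. b (Suc i) * d ^ i)"
    using Suc.prems(3) unfolding split .
  have 0: "a 0 = b 0"
    using arg_cong[OF eq, of "\<lambda>x. x mod d"] less by simp
  have "(\<Sum>i<N. a (Suc i) * d ^ i) = (\<Sum>i<N. b (Suc i) * d ^ i)"
    using eq 0 less by simp
  then have "a (Suc j) = b (Suc j)" if "j < N" for j
    using Suc.IH[of "\<lambda>i. a (Suc i)" "\<lambda>i. b (Suc i)" j] Suc.prems(1,2) that by auto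
  then show ?case using 0 Suc.prems(4) by (cases i) auto
qed simp

text \<open>Kronecker substitution: if \<open>d\<close> exceeds all exponents, then \<open>x\<^sub>j \<mapsto> t ^ (d ^ j)\<close> sends distinct monomials
  to distinct powers of \<open>t\<close>, hence nonzero polynomials to nonzero polynomials in one variable. These
  have only finitely many roots, so some real \<open>t\<close> avoids all of them. Treating several polynomials at once gives
  the absence of zero divisors as well.\<close>

lemma common_real_nonroot:
  fixes P :: "('n::finite, complex) mpoly set"
  assumes fin: "finite P" and nz: "0 \<notin> P"
  obtains \<xi> where "\<And>p. p \<in> P \<Longrightarrow> mpoly_eval p (real_point \<xi>) \<noteq> 0"
proof -
  let ?N = "card (UNIV :: 'n set)"
  obtain e :: "nat \<Rightarrow> 'n" where e: "bij_betw e {..<?N} UNIV"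
    using ex_bij_betw_nat_finite[of "UNIV :: 'n set"] by (auto simp: lessThan_atLeast0)
  define e' where "e' = the_inv_into {..<?N} e"
  have e': "e' (e j) = j" if "j < ?N" for j
    unfolding e'_def using e that by (intro the_inv_into_f_f) (auto simp: bij_betw_def)
  define K where "K = (\<Union>p\<in>P. Poly_Mapping.keys p)"
  define d where "d = Suc (Max ((\<lambda>(m, i). Poly_Mapping.lookup m i) ` (K \<times> UNIV)))"
  have finK: "finite K" using fin by (simp add: K_def)
  have d: "Poly_Mapping.lookup m i < d" if "m \<in> K" for m i
    unfolding d_def less_Suc_eq_le by (rule Max_ge) (use finK that in auto)
  define w where "w m = (\<Sum>i\<in>UNIV. Poly_Mapping.lookup m i * d ^ e' i)" for m :: "'n \<Rightarrow>\<^sub>0 nat"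
  have w: "w m = (\<Sum>j<?N. Poly_Mapping.lookup m (e j) * d ^ j)" for m
    unfolding w_def by (subst sum.reindex_bij_betw[OF e, symmetric]) (auto intro!: sum.cong simp: e')
  have inj: "m = m'" if "m \<in> K" "m' \<in> K" "w m = w m'" for m m'
  proof (rule poly_mapping_eqI)
    fix i
    obtain j where j: "j < ?N" "i = e j" using e by (auto simp: bij_betw_def)
    show "Poly_Mapping.lookup m i = Poly_Mapping.lookup m' i"
      unfolding j(2)
      by (rule base_expansion_unique[of "?N" "\<lambda>j. Poly_Mapping.lookup m (e j)" d "\<lambda>j. Poly_Mapping.lookup m' (e j)"])
        (use that d j w in auto)
  qed
  define Q where "Q p = (\<Sum>m\<in>Poly_Mapping.keys p. monom (Poly_Mapping.lookup p m) (w m))"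
    for p :: "('n, complex) mpoly"
  have Q0: "Q p \<noteq> 0" if "p \<in> P" for p
  proof -
    have "p \<noteq> 0" using that nz by auto
    then obtain m where m: "m \<in> Poly_Mapping.keys p" by (auto simp: poly_mapping_eq_iff in_keys_iff fun_eq_iff)
    have "coeff (Q p) (w m) = (\<Sum>m'\<in>Poly_Mapping.keys p. if m' = m then Poly_Mapping.lookup p m' else 0)"
      unfolding Q_def coeff_sum
      by (intro sum.cong refl) (use inj m that in \<open>auto simp: K_def\<close>)
    also have "\<dots> = Poly_Mapping.lookup p m" using m by simp
    finally show ?thesis using m by (auto simp: in_keys_iff)
  qed
  have evalQ: "mpoly_eval p (\<lambda>i. t ^ (d ^ e' i)) = poly (Q p) t" for p t
    unfolding mpoly_eval_def Q_def w_def
    by (simp add: poly_sum poly_monom power_sum mult.commute flip: power_mult)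
  have "finite (\<Union>p\<in>P. {t. poly (Q p) t = 0})"
    using fin Q0 by (auto intro: poly_roots_finite)
  moreover have "infinite (range complex_of_real)"
    using finite_imageD[of complex_of_real UNIV] infinite_UNIV_char_0[where 'a = real]
    by (auto simp: inj_on_def)
  ultimately obtain t where t: "complex_of_real t \<notin> (\<Union>p\<in>P. {t. poly (Q p) t = 0})"
    by (metis (no_types, lifting) finite_subset image_subsetI)
  show ?thesis
  proof (rule that)
    fix p assume "p \<in> P"
    then show "mpoly_eval p (real_point (\<lambda>i. t ^ (d ^ e' i))) \<noteq> 0"
      using t evalQ[of p "complex_of_real t"] by auto
  qed
qed

lemma mpoly_no_zero_divisors:
  fixes p q :: "('n::finite, complex) mpoly"
  assumes "p * q = 0"
  shows "p = 0 \<or> q = 0"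
proof (rule ccontr)
  assume "\<not> ?thesis"
  then obtain \<xi> where "mpoly_eval p (real_point \<xi>) \<noteq> 0" "mpoly_eval q (real_point \<xi>) \<noteq> 0"
    using common_real_nonroot[of "{p, q}"] by (metis empty_iff finite.emptyI finite.insertI insert_iff)
  then show False using mpoly_eval_mult[of p q "real_point \<xi>"] assms by simp
qed

text \<open>For \<open>h\<close> equal to \<open>Re\<close> or \<open>Im\<close>: on real points, the real and imaginary part of a complex polynomial
  are real polynomials, which turns complex equations into real ones.\<close>

lemma mpoly_eval_map_additive:
  fixes h :: "complex \<Rightarrow> real" and p :: "('n::finite, complex) mpoly"
  assumes add: "\<And>x y. h (x + y) = h x + h y" and scale: "\<And>x a. h (x * complex_of_real a) = h x * a"
  shows "mpoly_eval (Poly_Mapping.map h p) \<xi> = h (mpoly_eval p (real_point \<xi>))"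
proof -
  have h0: "h 0 = 0" using add[of 0 0] by simp
  have sum: "h (sum f S) = (\<Sum>x\<in>S. h (f x))" for f :: "_ \<Rightarrow> complex" and S
    by (induction S rule: infinite_finite_induct) (auto simp: h0 add)
  have lookup: "Poly_Mapping.lookup (Poly_Mapping.map h p) m = h (Poly_Mapping.lookup p m)" for m
    by (simp add: map.rep_eq when_def h0)
  have "mpoly_eval (Poly_Mapping.map h p) \<xi>
      = (\<Sum>m\<in>Poly_Mapping.keys p. h (Poly_Mapping.lookup p m) * (\<Prod>i\<in>UNIV. \<xi> i ^ Poly_Mapping.lookup m i))"
    by (subst mpoly_eval_superset[of "Poly_Mapping.keys p"]) (auto simp: lookup in_keys_iff h0)
  also have "\<dots> = h (mpoly_eval p (real_point \<xi>))"
    unfolding mpoly_eval_def sum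
    by (intro sum.cong refl) (simp flip: scale)
  finally show ?thesis .
qed

lemma algebraic_subvariety_real_zeros:
  fixes P :: "('n::finite, complex) mpoly set"
  shows "algebraic_subvariety {\<xi>. \<forall>p\<in>P. mpoly_eval p (real_point \<xi>) = 0}"
proof -
  have "mpoly_eval p (real_point \<xi>) = 0 \<longleftrightarrow>
      mpoly_eval (Poly_Mapping.map Re p) \<xi> = 0 \<and> mpoly_eval (Poly_Mapping.map Im p) \<xi> = 0"
    for p :: "('n, complex) mpoly" and \<xi>
    by (simp add: mpoly_eval_map_additive complex_eq_iff)
  then have "{\<xi>. \<forall>p\<in>P. mpoly_eval p (real_point \<xi>) = 0} =
      {\<xi>. \<forall>q \<in> Poly_Mapping.map Re ` P \<union> Poly_Mapping.map Im ` P. mpoly_eval q \<xi> = 0}"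
    by auto
  then show ?thesis unfolding algebraic_subvariety_def by blast
qed

section \<open>Quotient modules\<close>

locale submodule_quotient =
  fixes R (structure) and M and N
  assumes submod: "submodule R N M"
begin

sublocale Module.module R M
  using submod by (rule submodule.module)

sublocale abelian_subgroup N M
proof -
  have "subgroup N (add_monoid M)"
  proof
    show "N \<subseteq> carrier (add_monoid M)" using submodule.subset[OF submod] by simp
    show "inv\<^bsub>add_monoid M\<^esub> x \<in> N" if "x \<in> N" for x
    proof -
      have "x \<in> carrier M" using that submodule.subset[OF submod] by auto
      then have "\<ominus>\<^bsub>M\<^esub> x = (\<ominus> \<one>) \<odot>\<^bsub>M\<^esub> x" by (simp add: smult_minus_1)
      also have "\<dots> \<in> N" using submodule.smult_closed[OF submod] that by simp
      finally show ?thesis by (simp add: a_inv_def)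
    qed
  qed (use submodule.m_closed[OF submod] submodule.zero_closed[OF submod] in auto)
  then show "abelian_subgroup N M"
    by (intro abelian_subgroupI3 additive_subgroupI M.abelian_group_axioms)
qed

abbreviation "Q \<equiv> quotient_module M N"

lemma coset_carrier: "x \<in> carrier M \<Longrightarrow> N +>\<^bsub>M\<^esub> x \<in> carrier Q"
  by (auto simp: quotient_module_def A_RCOSETS_def' )

lemma carrier_cosetE:
  assumes "X \<in> carrier Q"
  obtains x where "x \<in> carrier M" "X = N +>\<^bsub>M\<^esub> x"
  using assms by (auto simp: quotient_module_def A_RCOSETS_def')

lemma coset_add:
  "x \<in> carrier M \<Longrightarrow> y \<in> carrier M \<Longrightarrow> (N +>\<^bsub>M\<^esub> x) \<oplus>\<^bsub>Q\<^esub> (N +>\<^bsub>M\<^esub> y) = N +>\<^bsub>M\<^esub> (x \<oplus>\<^bsub>M\<^esub> y)"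
  by (simp add: quotient_module_def a_rcos_sum)

lemma coset_eq_iff:
  assumes "x \<in> carrier M" "y \<in> carrier M"
  shows "N +>\<^bsub>M\<^esub> x = N +>\<^bsub>M\<^esub> y \<longleftrightarrow> x \<ominus>\<^bsub>M\<^esub> y \<in> N"
proof
  assume "N +>\<^bsub>M\<^esub> x = N +>\<^bsub>M\<^esub> y"
  then show "x \<ominus>\<^bsub>M\<^esub> y \<in> N"
    using a_rcos_self[OF assms(1)] a_rcos_module_imp[OF assms(2), of x] assms by (simp add: a_minus_def)
next
  assume "x \<ominus>\<^bsub>M\<^esub> y \<in> N"
  then have "x \<in> N +>\<^bsub>M\<^esub> y"
    using a_rcos_module_rev[OF assms(2,1)] by (simp add: a_minus_def)
  then show "N +>\<^bsub>M\<^esub> x = N +>\<^bsub>M\<^esub> y"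
    using a_repr_independence'[OF _ assms(2)] by simp
qed

text \<open>The scalar product of a quotient is a union over representatives; it is a single coset because any two
  representatives differ by an element of the submodule.\<close>

lemma coset_smult:
  assumes r: "r \<in> carrier R" and x: "x \<in> carrier M"
  shows "r \<odot>\<^bsub>Q\<^esub> (N +>\<^bsub>M\<^esub> x) = N +>\<^bsub>M\<^esub> (r \<odot>\<^bsub>M\<^esub> x)"
proof -
  have "N +>\<^bsub>M\<^esub> (r \<odot>\<^bsub>M\<^esub> y) = N +>\<^bsub>M\<^esub> (r \<odot>\<^bsub>M\<^esub> x)" if y: "y \<in> N +>\<^bsub>M\<^esub> x" for y
  proof -
    have yc: "y \<in> carrier M"
      using y a_r_coset_subset_G[OF a_subset x] by auto
    have "y \<ominus>\<^bsub>M\<^esub> x \<in> N"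
      using a_rcos_module_imp[OF x y] by (simp add: a_minus_def)
    then have "r \<odot>\<^bsub>M\<^esub> (y \<ominus>\<^bsub>M\<^esub> x) \<in> N"
      using submodule.smult_closed[OF submod] r by blast
    moreover have "r \<odot>\<^bsub>M\<^esub> (y \<ominus>\<^bsub>M\<^esub> x) = (r \<odot>\<^bsub>M\<^esub> y) \<ominus>\<^bsub>M\<^esub> (r \<odot>\<^bsub>M\<^esub> x)"
      using r x yc by (simp add: a_minus_def smult_r_distr smult_r_minus)
    ultimately show ?thesis
      using coset_eq_iff[of "r \<odot>\<^bsub>M\<^esub> y" "r \<odot>\<^bsub>M\<^esub> x"] r x yc by simp
  qed
  then have "(\<Union>y\<in>N +>\<^bsub>M\<^esub> x. N +>\<^bsub>M\<^esub> (r \<odot>\<^bsub>M\<^esub> y)) = N +>\<^bsub>M\<^esub> (r \<odot>\<^bsub>M\<^esub> x)"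
    using a_rcos_self[OF x] by blast
  then show ?thesis by (simp add: quotient_module_def)
qed

lemma coset_zero: "N +>\<^bsub>M\<^esub> \<zero>\<^bsub>M\<^esub> = \<zero>\<^bsub>Q\<^esub>"
  by (simp add: quotient_module_def a_coset_add_zero[OF a_subset])

lemma coset_eq_zero_iff:
  assumes "x \<in> carrier M"
  shows "N +>\<^bsub>M\<^esub> x = \<zero>\<^bsub>Q\<^esub> \<longleftrightarrow> x \<in> N"
  using coset_eq_iff[OF assms M.zero_closed] assms coset_zero
    M.minus_equality[of "\<zero>\<^bsub>M\<^esub>" "\<zero>\<^bsub>M\<^esub>"] by (simp add: a_minus_def)

lemma quotient_is_module: "Module.module R Q"
proof (rule module_criteria)
  show "cring R" by (rule R.is_cring)
  show "\<zero>\<^bsub>Q\<^esub> \<in> carrier Q" unfolding coset_zero[symmetric] by (rule coset_carrier) simp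
  show "\<forall>v\<in>carrier Q. \<exists>neg_v\<in>carrier Q. v \<oplus>\<^bsub>Q\<^esub> neg_v = \<zero>\<^bsub>Q\<^esub>"
  proof
    fix v assume "v \<in> carrier Q"
    then obtain x where x: "x \<in> carrier M" "v = N +>\<^bsub>M\<^esub> x" by (rule carrier_cosetE)
    then have "v \<oplus>\<^bsub>Q\<^esub> (N +>\<^bsub>M\<^esub> (\<ominus>\<^bsub>M\<^esub> x)) = \<zero>\<^bsub>Q\<^esub>"
      by (simp add: coset_add M.r_neg coset_zero)
    then show "\<exists>neg_v\<in>carrier Q. v \<oplus>\<^bsub>Q\<^esub> neg_v = \<zero>\<^bsub>Q\<^esub>"
      using x coset_carrier by blast
  qed
qed (auto elim!: carrier_cosetE intro!: coset_carrier
    simp: coset_add coset_smult coset_zero[symmetric] M.a_ac smult_assoc1 smult_l_distr smult_r_distr)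

lemma coset_hom: "(\<lambda>x. N +>\<^bsub>M\<^esub> x) \<in> LinearCombinations.module_hom R M Q"
  by (auto simp: LinearCombinations.module_hom_def coset_carrier coset_add coset_smult)

end

section \<open>Solution sets over an injective cogenerator\<close>

lemma hom_into_exactD:
  fixes F :: "('r::comm_ring_1, 'f, 'c) module_scheme" and M1 M2 M3 :: "'r test_module"
  assumes "hom_into_exact F" "is_module M1" "is_module M2" "is_module M3"
    and "f \<in> Hom M1 M2" "g \<in> Hom M2 M3"
    and "f ` carrier M1 = {x \<in> carrier M2. g x = \<zero>\<^bsub>M3\<^esub>}" and "h \<in> Hom M2 F"
  shows "(\<forall>x\<in>carrier M1. h (f x) = \<zero>\<^bsub>F\<^esub>) \<longleftrightarrow> (\<exists>h'\<in>Hom M3 F. \<forall>x\<in>carrier M2. h x = h' (g x))"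
proof -
  have conj: "is_module M1 \<and> is_module M2 \<and> is_module M3 \<and> f \<in> Hom M1 M2 \<and> g \<in> Hom M2 M3 \<and>
      f ` carrier M1 = {x \<in> carrier M2. g x = \<zero>\<^bsub>M3\<^esub>}"
    by (intro conjI assms)
  show ?thesis
    by (rule bspec[OF assms(1)[unfolded hom_into_exact_def, THEN spec[of _ M1], THEN spec[of _ M2],
          THEN spec[of _ M3], THEN spec[of _ f], THEN spec[of _ g], THEN mp, OF conj] assms(8)])
qed

text \<open>The cogenerator property gives a nonzero homomorphism \<open>h\<close> on the cyclic submodule generated by \<open>u\<close>, and
  \<open>h u \<noteq> 0\<close> because \<open>u\<close> generates. Exactness of \<open>Hom(\<cdot>, F)\<close> at \<open>0 \<rightarrow> R u \<rightarrow> M\<close> extends \<open>h\<close> to \<open>M\<close>.\<close>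

lemma injective_cogenerator_separates:
  fixes F :: "('r::comm_ring_1, 'f, 'c) module_scheme" and M :: "'r test_module"
  assumes F: "injective_cogenerator F" and M: "is_module M"
    and u: "u \<in> carrier M" "u \<noteq> \<zero>\<^bsub>M\<^esub>"
  obtains h where "h \<in> Hom M F" "h u \<noteq> \<zero>\<^bsub>F\<^esub>"
proof -
  interpret F: Module.module class_ring F using F by (simp add: injective_cogenerator_def)
  interpret M: Module.module class_ring M by (rule M)
  note [simp] = M.smult_closed[simplified] M.smult_l_distr[simplified] M.smult_r_distr[simplified]
    M.smult_assoc1[simplified] M.smult_one[simplified]
  define C where "C = range (\<lambda>r. r \<odot>\<^bsub>M\<^esub> u)"
  have C: "submodule class_ring C M"
  proof (rule submodule.intro[OF M])
    show "C \<subseteq> carrier M" using u by (auto simp: C_def)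
    show "v \<oplus>\<^bsub>M\<^esub> w \<in> C" if "v \<in> C" "w \<in> C" for v w
      using that u unfolding C_def by (auto simp flip: M.smult_l_distr[simplified])
    have "\<zero>\<^bsub>M\<^esub> = 0 \<odot>\<^bsub>M\<^esub> u" using M.smult_l_null[OF u(1)] by simp
    then show "\<zero>\<^bsub>M\<^esub> \<in> C" unfolding C_def by blast
    show "c \<odot>\<^bsub>M\<^esub> v \<in> C" if "v \<in> C" for c v
      using that u unfolding C_def by (auto simp flip: M.smult_assoc1[simplified])
  qed
  define MC where "MC = M\<lparr>carrier := C\<rparr>"
  have MC: "is_module MC" unfolding MC_def by (rule M.submodule_is_module[OF C])
  have CM: "C \<subseteq> carrier M" using submodule.subset[OF C] .
  have uC: "u \<in> C"
    unfolding C_def by (rule range_eqI[of _ _ 1]) (use u in simp)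
  have "carrier MC \<noteq> {\<zero>\<^bsub>MC\<^esub>}" using uC u by (auto simp: MC_def)
  then obtain h x where h: "h \<in> Hom MC F" and x: "x \<in> carrier MC" "h x \<noteq> \<zero>\<^bsub>F\<^esub>"
    using F MC unfolding injective_cogenerator_def by blast
  have hu: "h u \<noteq> \<zero>\<^bsub>F\<^esub>"
  proof
    assume 0: "h u = \<zero>\<^bsub>F\<^esub>"
    obtain r where r: "x = r \<odot>\<^bsub>M\<^esub> u" using x by (auto simp: MC_def C_def)
    have "h x = r \<odot>\<^bsub>F\<^esub> h u"
      using LinearCombinations.module_hom_smult[OF h, of r u] uC r by (simp add: MC_def)
    then show False using x 0 F.smult_r_null[of r] by simp
  qed
  define Z where "Z = M\<lparr>carrier := {\<zero>\<^bsub>M\<^esub>}\<rparr>"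
  have "submodule class_ring {\<zero>\<^bsub>M\<^esub>} M"
    by (rule submodule.intro[OF M]) (use M.smult_r_null in auto)
  then have Z: "is_module Z" unfolding Z_def by (rule M.submodule_is_module)
  have id1: "(\<lambda>x. x) \<in> Hom Z MC"
    using submodule.zero_closed[OF C] by (auto simp: LinearCombinations.module_hom_def Z_def MC_def)
  have id2: "(\<lambda>x. x) \<in> Hom MC M"
    using CM by (auto simp: LinearCombinations.module_hom_def MC_def)
  have ex: "(\<lambda>x. x) ` carrier Z = {x \<in> carrier MC. x = \<zero>\<^bsub>M\<^esub>}"
    using submodule.zero_closed[OF C] by (auto simp: Z_def MC_def)
  have h0: "h \<zero>\<^bsub>M\<^esub> = \<zero>\<^bsub>F\<^esub>"
  proof -
    have "h (0 \<odot>\<^bsub>M\<^esub> u) = 0 \<odot>\<^bsub>F\<^esub> h u" 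
      using LinearCombinations.module_hom_smult[OF h, of 0 u] uC by (simp add: MC_def)
    moreover have "h u \<in> carrier F" using LinearCombinations.module_hom_closed[OF h] uC by (auto simp: MC_def)
    ultimately show ?thesis using M.smult_l_null[OF u(1)] F.smult_l_null[of "h u"] by simp
  qed
  have "\<forall>x\<in>carrier Z. h x = \<zero>\<^bsub>F\<^esub>" using h0 by (simp add: Z_def)
  moreover have "hom_into_exact F" using F by (simp add: injective_cogenerator_def)
  ultimately have "\<exists>h'\<in>Hom M F. \<forall>x\<in>carrier MC. h x = h' x"
    using hom_into_exactD[OF _ Z MC M id1 id2 ex h] by blast
  then obtain h' where h': "h' \<in> Hom M F" "\<forall>x\<in>carrier MC. h x = h' x" by blast
  then show ?thesis using that[OF h'(1)] hu uC by (simp add: MC_def)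
qed

lemma mat_image_submodule:
  fixes B :: "'r::comm_ring_1 mat"
  assumes B: "B \<in> carrier_mat k l"
  shows "submodule class_ring (mat_image B) (module_vec TYPE('r) k)"
proof -
  interpret vec_module "TYPE('r)" k .
  show ?thesis
  proof (rule submodule.intro)
    show "is_module (module_vec TYPE('r) k)" by (rule module_axioms)
    show "mat_image B \<subseteq> carrier (module_vec TYPE('r) k)"
      using B by (auto simp: mat_image_def module_vec_simps)
    show "v \<oplus>\<^bsub>module_vec TYPE('r) k\<^esub> w \<in> mat_image B" if "v \<in> mat_image B" "w \<in> mat_image B" for v w
      using that B unfolding mat_image_def
      by (auto simp: module_vec_simps mult_add_distrib_mat_vec[symmetric] intro!: imageI)
    show "\<zero>\<^bsub>module_vec TYPE('r) k\<^esub> \<in> mat_image B"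
      unfolding mat_image_def by (rule image_eqI[of _ _ "0\<^sub>v l"]) (use B in \<open>auto simp: module_vec_simps\<close>)
    show "c \<odot>\<^bsub>module_vec TYPE('r) k\<^esub> v \<in> mat_image B" if "v \<in> mat_image B" for c v
    proof -
      obtain z where z: "z \<in> carrier_vec l" "v = B *\<^sub>v z" using \<open>v \<in> mat_image B\<close> B by (auto simp: mat_image_def)
      then have "c \<cdot>\<^sub>v v = B *\<^sub>v (c \<cdot>\<^sub>v z)" using B by (intro eq_vecI) auto
      then show ?thesis using z B by (auto simp: module_vec_simps mat_image_def)
    qed
  qed
qed

lemma coker_transpose_quotient:
  fixes A :: "'r::comm_ring_1 mat"
  shows "submodule_quotient class_ring (module_vec TYPE('r) (dim_col A)) (mat_image A\<^sup>T)"
  by (intro submodule_quotient.intro mat_image_submodule[of _ _ "dim_row A"]) simp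

lemma torsion_coker_transpose_iff:
  fixes A :: "'r::comm_ring_1 mat"
  shows "torsion_module (coker_transpose A) \<longleftrightarrow>
    (\<forall>w\<in>carrier_vec (dim_col A). \<exists>r. r \<noteq> 0 \<and> r \<cdot>\<^sub>v w \<in> mat_image A\<^sup>T)"
proof -
  let ?V = "module_vec TYPE('r) (dim_col A)"
  interpret submodule_quotient class_ring ?V "mat_image A\<^sup>T" by (rule coker_transpose_quotient)
  have zero: "r \<odot>\<^bsub>Q\<^esub> (mat_image A\<^sup>T +>\<^bsub>?V\<^esub> w) = \<zero>\<^bsub>Q\<^esub> \<longleftrightarrow> r \<cdot>\<^sub>v w \<in> mat_image A\<^sup>T"
    if "w \<in> carrier_vec (dim_col A)" for r w
    using that coset_smult[of r w] coset_eq_zero_iff[of "r \<cdot>\<^sub>v w"] by (simp add: module_vec_simps)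
  show ?thesis
  proof
    assume "torsion_module (coker_transpose A)"
    then show "\<forall>w\<in>carrier_vec (dim_col A). \<exists>r. r \<noteq> 0 \<and> r \<cdot>\<^sub>v w \<in> mat_image A\<^sup>T"
      unfolding torsion_module_def coker_transpose_def
      using coset_carrier zero by (metis module_vec_simps(3))
  next
    assume R: "\<forall>w\<in>carrier_vec (dim_col A). \<exists>r. r \<noteq> 0 \<and> r \<cdot>\<^sub>v w \<in> mat_image A\<^sup>T"
    show "torsion_module (coker_transpose A)"
      unfolding torsion_module_def coker_transpose_def
    proof
      fix X assume "X \<in> carrier Q"
      then obtain w where "w \<in> carrier ?V" "X = mat_image A\<^sup>T +>\<^bsub>?V\<^esub> w" by (rule carrier_cosetE)
      then show "\<exists>r. r \<noteq> 0 \<and> r \<odot>\<^bsub>Q\<^esub> X = \<zero>\<^bsub>Q\<^esub>"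
        using R zero by (simp add: module_vec_simps)
    qed
  qed
qed

lemma hom_from_free_module:
  fixes F :: "('r::comm_ring_1, 'f, 'c) module_scheme"
  assumes F: "is_module F" and q: "q \<in> Hom (module_vec TYPE('r) k) F" and u: "u \<in> carrier_vec k"
  shows "q u = (\<Oplus>\<^bsub>F\<^esub>j\<in>{..<k}. u $ j \<odot>\<^bsub>F\<^esub> q (unit_vec k j))"
proof -
  interpret F: Module.module class_ring F by (rule F)
  have closed: "q v \<in> carrier F" if "v \<in> carrier_vec k" for v
    using LinearCombinations.module_hom_closed[OF q] that by (auto simp: module_vec_simps)
  have q0: "q (0\<^sub>v k) = \<zero>\<^bsub>F\<^esub>"
  proof -
    have "q (0 \<cdot>\<^sub>v 0\<^sub>v k) = 0 \<odot>\<^bsub>F\<^esub> q (0\<^sub>v k)"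
      using LinearCombinations.module_hom_smult[OF q, of 0 "0\<^sub>v k"] by (simp add: module_vec_simps)
    moreover have "0 \<cdot>\<^sub>v 0\<^sub>v k = (0\<^sub>v k :: 'r vec)" by auto
    ultimately show ?thesis using F.smult_l_null[of "q (0\<^sub>v k)"] closed by simp
  qed
  have "q (vec k (\<lambda>i. if i \<in> J then u $ i else 0)) = (\<Oplus>\<^bsub>F\<^esub>j\<in>J. u $ j \<odot>\<^bsub>F\<^esub> q (unit_vec k j))"
    if "finite J" "J \<subseteq> {..<k}" for J
    using that
  proof (induction J)
    case empty
    have "vec k (\<lambda>i. if i \<in> {} then u $ i else 0) = 0\<^sub>v k" by auto
    then show ?case using q0 by simp
  next
    case (insert j J)
    let ?v = "vec k (\<lambda>i. if i \<in> J then u $ i else 0)"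
    have split: "vec k (\<lambda>i. if i \<in> insert j J then u $ i else 0) = u $ j \<cdot>\<^sub>v unit_vec k j + ?v"
      using insert by (intro eq_vecI) auto
    have "q (u $ j \<cdot>\<^sub>v unit_vec k j + ?v) = q (u $ j \<cdot>\<^sub>v unit_vec k j) \<oplus>\<^bsub>F\<^esub> q ?v"
      using LinearCombinations.module_hom_add[OF q, of "u $ j \<cdot>\<^sub>v unit_vec k j" ?v] by (simp add: module_vec_simps)
    also have "q (u $ j \<cdot>\<^sub>v unit_vec k j) = u $ j \<odot>\<^bsub>F\<^esub> q (unit_vec k j)"
      using LinearCombinations.module_hom_smult[OF q, of "u $ j" "unit_vec k j"] by (simp add: module_vec_simps)
    finally show ?case
      unfolding split using insert closed
      by (subst F.finsum_insert) (auto intro!: F.smult_closed)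
  qed
  from this[of "{..<k}"] have "q (vec k (\<lambda>i. if i < k then u $ i else 0)) = (\<Oplus>\<^bsub>F\<^esub>j\<in>{..<k}. u $ j \<odot>\<^bsub>F\<^esub> q (unit_vec k j))"
    by simp
  moreover have "vec k (\<lambda>i. if i < k then u $ i else 0) = u" using u by auto
  ultimately show ?thesis by simp
qed

text \<open>The class of \<open>w\<close> in \<open>R\<^sup>k / im B\<^sup>T\<close> is nonzero, so some homomorphism \<open>h\<close> from this quotient to \<open>F\<close> does not kill
  it. A homomorphism from the quotient is the same as a solution: the images of the unit vectors form a
  vector \<open>v\<close> with \<open>u \<bullet> v = h [u]\<close> for all \<open>u\<close>, in particular \<open>B v = 0\<close> because the rows of \<open>B\<close> are zero in the quotient.\<close>

lemma solution_outside_row_module: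
  fixes F :: "('r::comm_ring_1, 'f, 'c) module_scheme" and B :: "'r mat"
  assumes F: "injective_cogenerator F"
    and w: "w \<in> carrier_vec (dim_col B)" "w \<notin> mat_image B\<^sup>T"
  obtains v where "v \<in> module_kernel F B"
    "(\<Oplus>\<^bsub>F\<^esub>j\<in>{..<dim_col B}. w $ j \<odot>\<^bsub>F\<^esub> v $ j) \<noteq> \<zero>\<^bsub>F\<^esub>"
proof -
  let ?k = "dim_col B"
  let ?V = "module_vec TYPE('r) ?k" and ?N = "mat_image B\<^sup>T"
  interpret submodule_quotient class_ring ?V ?N by (rule coker_transpose_quotient)
  have Fmod: "is_module F" using F by (simp add: injective_cogenerator_def)
  interpret F: Module.module class_ring F by (rule Fmod)
  have "?N +>\<^bsub>?V\<^esub> w \<in> carrier Q" "?N +>\<^bsub>?V\<^esub> w \<noteq> \<zero>\<^bsub>Q\<^esub>"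
    using coset_carrier[of w] coset_eq_zero_iff[of w] w by (auto simp: module_vec_simps)
  then obtain h where h: "h \<in> Hom Q F" and hw: "h (?N +>\<^bsub>?V\<^esub> w) \<noteq> \<zero>\<^bsub>F\<^esub>"
    using injective_cogenerator_separates[OF F quotient_is_module] by blast
  define q where "q x = h (?N +>\<^bsub>?V\<^esub> x)" for x
  have q: "q \<in> Hom ?V F"
    using h coset_hom unfolding q_def LinearCombinations.module_hom_def by (auto simp: Pi_iff)
  define v where "v = vec ?k (\<lambda>j. q (unit_vec ?k j))"
  have sum: "(\<Oplus>\<^bsub>F\<^esub>j\<in>{..<?k}. u $ j \<odot>\<^bsub>F\<^esub> v $ j) = q u" if "u \<in> carrier_vec ?k" for u
    unfolding hom_from_free_module[OF Fmod q that]
    by (intro F.finsum_cong') (use LinearCombinations.module_hom_closed[OF q] in \<open>auto simp: v_def module_vec_simps Pi_iff intro!: F.smult_closed\<close>)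
  have h0: "h \<zero>\<^bsub>Q\<^esub> = \<zero>\<^bsub>F\<^esub>"
    by (rule mod_hom.f0_is_0[of class_ring]) (intro mod_hom.intro mod_hom_axioms.intro quotient_is_module Fmod h)
  have "v \<in> module_kernel F B"
    unfolding module_kernel_def
  proof (intro CollectI conjI allI impI)
    show "v \<in> carrier_vec ?k" by (simp add: v_def)
    show "v $ j \<in> carrier F" if "j < ?k" for j
      using that LinearCombinations.module_hom_closed[OF q] by (auto simp: v_def module_vec_simps)
    fix i assume i: "i < dim_row B"
    have "row B i = B\<^sup>T *\<^sub>v unit_vec (dim_row B) i"
      using i by (intro eq_vecI) auto
    then have "row B i \<in> ?N" by (auto simp: mat_image_def)
    then have "q (row B i) = \<zero>\<^bsub>F\<^esub>"
      unfolding q_def using coset_eq_zero_iff[of "row B i"] h0 by (simp add: module_vec_simps)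
    moreover have "(\<Oplus>\<^bsub>F\<^esub>j\<in>{..<?k}. B $$ (i, j) \<odot>\<^bsub>F\<^esub> v $ j) = (\<Oplus>\<^bsub>F\<^esub>j\<in>{..<?k}. row B i $ j \<odot>\<^bsub>F\<^esub> v $ j)"
      by (intro F.finsum_cong') (use i LinearCombinations.module_hom_closed[OF q] in \<open>auto simp: v_def module_vec_simps Pi_iff intro!: F.smult_closed\<close>)
    ultimately show "(\<Oplus>\<^bsub>F\<^esub>j\<in>{..<?k}. B $$ (i, j) \<odot>\<^bsub>F\<^esub> v $ j) = \<zero>\<^bsub>F\<^esub>"
      using sum[of "row B i"] by simp
  qed
  moreover have "(\<Oplus>\<^bsub>F\<^esub>j\<in>{..<?k}. w $ j \<odot>\<^bsub>F\<^esub> v $ j) \<noteq> \<zero>\<^bsub>F\<^esub>"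
    using sum[OF w(1)] hw by (simp add: q_def)
  ultimately show ?thesis by (rule that)
qed

lemma module_kernel_dim_col_unique:
  fixes F :: "('r::comm_ring_1, 'f, 'c) module_scheme" and A B :: "'r mat"
  assumes F: "is_module F" and eq: "module_kernel F A = module_kernel F B"
  shows "dim_col A = dim_col B"
proof -
  interpret F: Module.module class_ring F by (rule F)
  have "(\<Oplus>\<^bsub>F\<^esub>j\<in>{..<dim_col A}. A $$ (i, j) \<odot>\<^bsub>F\<^esub> vec (dim_col A) (\<lambda>_. \<zero>\<^bsub>F\<^esub>) $ j) = (\<Oplus>\<^bsub>F\<^esub>j\<in>{..<dim_col A}. \<zero>\<^bsub>F\<^esub>)" for i
    using F.smult_r_null by (intro F.finsum_cong') auto
  then have "vec (dim_col A) (\<lambda>_. \<zero>\<^bsub>F\<^esub>) \<in> module_kernel F A"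
    unfolding module_kernel_def by simp
  then have "vec (dim_col A) (\<lambda>_. \<zero>\<^bsub>F\<^esub>) \<in> carrier_vec (dim_col B)"
    unfolding eq by (simp add: module_kernel_def)
  then show ?thesis by simp
qed

text \<open>A row of \<open>B\<close> outside the row module of \<open>A\<close> would be detected by a solution of \<open>A\<close>, which is not a
  solution of \<open>B\<close>.\<close>

lemma row_module_antimono_module_kernel:
  fixes F :: "('r::comm_ring_1, 'f, 'c) module_scheme" and A B :: "'r mat"
  assumes F: "injective_cogenerator F" and sub: "module_kernel F A \<subseteq> module_kernel F B"
    and dim: "dim_col B = dim_col A"
  shows "mat_image B\<^sup>T \<subseteq> mat_image A\<^sup>T"
proof -
  let ?k = "dim_col A"
  have rows: "row B i \<in> mat_image A\<^sup>T" if i: "i < dim_row B" for i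
  proof (rule ccontr)
    assume notin: "row B i \<notin> mat_image A\<^sup>T"
    have "row B i \<in> carrier_vec ?k" using dim by (intro carrier_vecI) simp
    from this notin obtain v where v: "v \<in> module_kernel F A"
      "(\<Oplus>\<^bsub>F\<^esub>j\<in>{..<?k}. row B i $ j \<odot>\<^bsub>F\<^esub> v $ j) \<noteq> \<zero>\<^bsub>F\<^esub>"
      by (rule solution_outside_row_module[OF F])
    interpret F: Module.module class_ring F using F by (simp add: injective_cogenerator_def)
    have "v \<in> module_kernel F B" using v sub by auto
    then have "(\<Oplus>\<^bsub>F\<^esub>j\<in>{..<?k}. B $$ (i, j) \<odot>\<^bsub>F\<^esub> v $ j) = \<zero>\<^bsub>F\<^esub>" "\<forall>j<?k. v $ j \<in> carrier F"
      using i dim by (auto simp: module_kernel_def)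
    moreover have "(\<Oplus>\<^bsub>F\<^esub>j\<in>{..<?k}. row B i $ j \<odot>\<^bsub>F\<^esub> v $ j) = (\<Oplus>\<^bsub>F\<^esub>j\<in>{..<?k}. B $$ (i, j) \<odot>\<^bsub>F\<^esub> v $ j)"
      by (intro F.finsum_cong') (use calculation i dim in \<open>auto intro!: F.smult_closed\<close>)
    ultimately show False using v by simp
  qed
  have "B\<^sup>T *\<^sub>v z \<in> mat_image A\<^sup>T" if z: "z \<in> carrier_vec (dim_row B)" for z
  proof -
    have "\<forall>i. \<exists>y. i < dim_row B \<longrightarrow> y \<in> carrier_vec (dim_row A) \<and> row B i = A\<^sup>T *\<^sub>v y"
      using rows unfolding mat_image_def by fastforce
    from choice[OF this] obtain Y where Y: "\<And>i. i < dim_row B \<Longrightarrow> Y i \<in> carrier_vec (dim_row A)"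
      "\<And>i. i < dim_row B \<Longrightarrow> row B i = A\<^sup>T *\<^sub>v Y i" by blast
    define X where "X = mat (dim_row A) (dim_row B) (\<lambda>(a, i). Y i $ a)"
    have X: "X \<in> carrier_mat (dim_row A) (dim_row B)" by (simp add: X_def)
    have "B\<^sup>T = A\<^sup>T * X"
    proof (rule eq_matI)
      fix j i assume "j < dim_row (A\<^sup>T * X)" "i < dim_col (A\<^sup>T * X)"
      then have ji: "j < dim_col A" "i < dim_row B" by (auto simp: X_def)
      have "col X i = Y i" using Y(1)[OF ji(2)] ji by (auto simp: X_def)
      then have "(A\<^sup>T * X) $$ (j, i) = (A\<^sup>T *\<^sub>v Y i) $ j" using ji by (simp add: X_def)
      also have "\<dots> = B\<^sup>T $$ (j, i)" using Y(2)[OF ji(2), symmetric] ji dim by simp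
      finally show "B\<^sup>T $$ (j, i) = (A\<^sup>T * X) $$ (j, i)" ..
    qed (auto simp: X_def dim)
    then have "B\<^sup>T *\<^sub>v z = A\<^sup>T *\<^sub>v (X *\<^sub>v z)"
      using assoc_mult_mat_vec[of "A\<^sup>T" "dim_col A" "dim_row A" X "dim_row B" z] X z by simp
    then show ?thesis using X z by (auto simp: mat_image_def)
  qed
  then show ?thesis by (auto simp: mat_image_def)
qed

text \<open>If \<open>B\<close> presents the same solution set, the row module of \<open>B\<close> lies in that of \<open>A\<close>, and a quotient of a
  torsion module is torsion.\<close>

lemma uncontrollable_iff_torsion:
  fixes F :: "('r::comm_ring_1, 'f, 'c) module_scheme" and A :: "'r mat"
  assumes F: "injective_cogenerator F"
  shows "uncontrollable F (module_kernel F A) \<longleftrightarrow> torsion_module (coker_transpose A)"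
proof
  assume "uncontrollable F (module_kernel F A)"
  then obtain B where eq: "module_kernel F A = module_kernel F B"
    and tors: "torsion_module (coker_transpose B)"
    unfolding uncontrollable_def by blast
  have dim: "dim_col B = dim_col A"
    using module_kernel_dim_col_unique[OF _ eq] F by (simp add: injective_cogenerator_def)
  have "mat_image B\<^sup>T \<subseteq> mat_image A\<^sup>T"
    by (rule row_module_antimono_module_kernel[OF F _ dim]) (simp add: eq)
  then show "torsion_module (coker_transpose A)"
    using tors unfolding torsion_coker_transpose_iff dim by blast
qed (auto simp: uncontrollable_def)

section \<open>Generic rank and rank drop\<close>

lemma minor_mat_at:
  assumes "\<forall>i<r. f i < dim_row A" "\<forall>j<r. g j < dim_col A"
  shows "minor (mat_at A \<xi>) r f g = mpoly_eval (minor A r f g) \<xi>"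
proof -
  have "mat r r (\<lambda>(i, j). mat_at A \<xi> $$ (f i, g j))
      = map_mat (\<lambda>p. mpoly_eval p \<xi>) (mat r r (\<lambda>(i, j). A $$ (f i, g j)))"
    using assms by (intro eq_matI) (auto simp: mat_at_def)
  then show ?thesis by (simp add: minor_def mpoly_eval.hom_det)
qed

lemma minors_mat_at: "minors (mat_at A \<xi>) r = (\<lambda>p. mpoly_eval p \<xi>) ` minors A r"
proof -
  have dims: "dim_row (mat_at A \<xi>) = dim_row A" "dim_col (mat_at A \<xi>) = dim_col A"
    by (auto simp: mat_at_def)
  show ?thesis
  proof (intro equalityI subsetI)
    fix c assume "c \<in> minors (mat_at A \<xi>) r"
    then obtain f g where fg: "\<forall>i<r. f i < dim_row A" "\<forall>j<r. g j < dim_col A"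
      "c = minor (mat_at A \<xi>) r f g"
      unfolding minors_def dims by blast
    then have "c = mpoly_eval (minor A r f g) \<xi>" by (simp add: minor_mat_at)
    moreover have "minor A r f g \<in> minors A r" using fg unfolding minors_def by blast
    ultimately show "c \<in> (\<lambda>p. mpoly_eval p \<xi>) ` minors A r" by (rule image_eqI)
  next
    fix c assume "c \<in> (\<lambda>p. mpoly_eval p \<xi>) ` minors A r"
    then obtain f g where fg: "\<forall>i<r. f i < dim_row A" "\<forall>j<r. g j < dim_col A"
      "c = mpoly_eval (minor A r f g) \<xi>"
      unfolding minors_def by blast
    then have "c = minor (mat_at A \<xi>) r f g" by (simp add: minor_mat_at)
    then show "c \<in> minors (mat_at A \<xi>) r" using fg unfolding minors_def dims by blast
  qed
qed

lemma has_minor_mat_at_imp: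
  assumes "has_minor (mat_at A \<xi>) r"
  shows "has_minor A r"
proof -
  obtain p where "p \<in> minors A r" "mpoly_eval p \<xi> \<noteq> 0"
    using assms by (auto simp: has_minor_iff_minors minors_mat_at)
  moreover from this have "p \<noteq> 0" by auto
  ultimately show ?thesis by (auto simp: has_minor_iff_minors)
qed

text \<open>That a minor is nonzero at a real point is no more than that it is nonzero. This is why the
  real variety of rank drop is proper.\<close>

lemma has_minor_iff_real_point:
  fixes A :: "('n::finite, complex) mpoly mat"
  shows "has_minor A r \<longleftrightarrow> (\<exists>\<xi>. has_minor (mat_at A (real_point \<xi>)) r)"
proof
  assume "has_minor A r"
  then obtain p where p: "p \<in> minors A r" "p \<noteq> 0" by (auto simp: has_minor_iff_minors)
  obtain \<xi> where "mpoly_eval p (real_point \<xi>) \<noteq> 0"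
    using common_real_nonroot[of "{p}"] p by auto
  then show "\<exists>\<xi>. has_minor (mat_at A (real_point \<xi>)) r"
    using p by (auto simp: has_minor_iff_minors minors_mat_at)
next
  assume "\<exists>\<xi>. has_minor (mat_at A (real_point \<xi>)) r"
  then show "has_minor A r" using has_minor_mat_at_imp by blast
qed

lemma le_generic_rank_iff:
  fixes A :: "('n::finite, complex) mpoly mat"
  shows "r \<le> generic_rank A \<longleftrightarrow> has_minor A r"
proof -
  let ?S = "range (\<lambda>\<eta>. mat_rank (mat_at A \<eta>))"
  have "mat_rank (mat_at A \<eta>) \<le> dim_col A" for \<eta>
    using has_minor_le_dim_col has_minor_mat_at_imp has_minor_iff_le_rank by blast
  then have "finite ?S" by (intro finite_subset[of ?S "{..dim_col A}"]) auto
  then have "r \<le> generic_rank A \<longleftrightarrow> (\<exists>\<eta>. r \<le> mat_rank (mat_at A \<eta>))"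
    unfolding generic_rank_def by (subst Max_ge_iff) auto
  also have "\<dots> \<longleftrightarrow> has_minor A r"
    unfolding has_minor_iff_le_rank[symmetric]
    using has_minor_mat_at_imp has_minor_iff_real_point[of A r] by blast
  finally show ?thesis .
qed

lemma rank_drop_iff:
  fixes A :: "('n::finite, complex) mpoly mat"
  shows "mat_rank (mat_at A \<xi>) \<noteq> generic_rank A \<longleftrightarrow> (\<forall>p\<in>minors A (generic_rank A). mpoly_eval p \<xi> = 0)"
proof -
  have "mat_rank (mat_at A \<xi>) \<le> generic_rank A"
    unfolding le_generic_rank_iff using has_minor_iff_le_rank has_minor_mat_at_imp by blast
  then have "mat_rank (mat_at A \<xi>) \<noteq> generic_rank A \<longleftrightarrow> \<not> has_minor (mat_at A \<xi>) (generic_rank A)"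
    unfolding has_minor_iff_le_rank by linarith
  then show ?thesis by (simp add: has_minor_iff_minors minors_mat_at)
qed

lemma proper_subvariety_rank_drop:
  fixes A :: "('n::finite, complex) mpoly mat"
  shows "proper_subvariety (complex_rank_drop A)" "proper_subvariety (real_rank_drop A)"
proof -
  have "has_minor A (generic_rank A)" unfolding le_generic_rank_iff[symmetric] ..
  then obtain \<xi> where \<xi>: "has_minor (mat_at A (real_point \<xi>)) (generic_rank A)"
    unfolding has_minor_iff_real_point by blast
  then have "real_point \<xi> \<notin> complex_rank_drop A" "\<xi> \<notin> real_rank_drop A"
    by (auto simp: complex_rank_drop_def real_rank_drop_def rank_drop_iff has_minor_iff_minors minors_mat_at)
  then have "complex_rank_drop A \<noteq> UNIV" "real_rank_drop A \<noteq> UNIV" by auto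
  moreover have "algebraic_subvariety (complex_rank_drop A)"
    unfolding algebraic_subvariety_def complex_rank_drop_def rank_drop_iff by (rule exI) (rule refl)
  moreover have "algebraic_subvariety (real_rank_drop A)"
    unfolding real_rank_drop_def rank_drop_iff by (rule algebraic_subvariety_real_zeros)
  ultimately show "proper_subvariety (complex_rank_drop A)" "proper_subvariety (real_rank_drop A)"
    by (auto simp: proper_subvariety_def)
qed

lemma kernel_mat_at_zero_iff:
  fixes A :: "('n::finite, complex) mpoly mat"
  assumes "A \<in> carrier_mat l k"
  shows "mat_kernel (mat_at A \<xi>) = {0\<^sub>v k} \<longleftrightarrow> has_minor (mat_at A \<xi>) k"
  by (rule kernel_zero_iff_has_minor[of _ l]) (use assms in \<open>auto simp: mat_at_def\<close>)

lemma polynomial_kernel_zero_iff: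
  fixes A :: "('n::finite, complex) mpoly mat"
  assumes "A \<in> carrier_mat l k"
  shows "mat_kernel A = {0\<^sub>v k} \<longleftrightarrow> has_minor A k"
  using kernel_zero_iff_has_minor[OF assms] mpoly_no_zero_divisors by blast

section \<open>Torsion and syzygies\<close>

text \<open>If \<open>r e\<^sub>j = A\<^sup>T z\<close> and \<open>A w = 0\<close>, then \<open>r w\<^sub>j = z \<bullet> A w = 0\<close>. In the other direction, the transpose of
  \<open>Z A = d\<cdot>1\<close> shows that \<open>d\<close> annihilates the whole cokernel.\<close>

lemma torsion_iff_kernel_zero:
  fixes A :: "('n::finite, complex) mpoly mat"
  assumes A: "A \<in> carrier_mat l k"
  shows "torsion_module (coker_transpose A) \<longleftrightarrow> mat_kernel A = {0\<^sub>v k}"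
proof
  assume tors: "torsion_module (coker_transpose A)"
  have "w = 0\<^sub>v k" if w: "w \<in> mat_kernel A" for w
  proof (rule eq_vecI)
    have wk: "w \<in> carrier_vec k" and Aw: "A *\<^sub>v w = 0\<^sub>v l" using mat_kernelD[OF A w] by auto
    then show "dim_vec w = dim_vec (0\<^sub>v k :: ('n, complex) mpoly vec)" by simp
    fix j assume "j < dim_vec (0\<^sub>v k :: ('n, complex) mpoly vec)"
    then have j: "j < k" by simp
    have "unit_vec k j \<in> carrier_vec (dim_col A)" using A by simp
    then obtain r where r: "r \<noteq> 0" "r \<cdot>\<^sub>v unit_vec k j \<in> mat_image A\<^sup>T"
      using tors unfolding torsion_coker_transpose_iff by blast
    then obtain z where z: "z \<in> carrier_vec l" "r \<cdot>\<^sub>v unit_vec k j = A\<^sup>T *\<^sub>v z"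
      using A unfolding mat_image_def by (metis carrier_matD(1) imageE index_transpose_mat(3))
    have "r * w $ j = (r \<cdot>\<^sub>v unit_vec k j) \<bullet> w"
      using wk j scalar_prod_left_unit[OF wk j] by simp
    also have "\<dots> = z \<bullet> (A *\<^sub>v w)"
      unfolding z(2) using transpose_vec_mult_scalar[OF A wk z(1)] wk z A
      by (metis comm_scalar_prod mult_mat_vec_carrier transpose_carrier_mat)
    also have "\<dots> = 0" using Aw z by simp
    finally show "w $ j = 0\<^sub>v k $ j" using r mpoly_no_zero_divisors j by auto
  qed
  moreover have "0\<^sub>v k \<in> mat_kernel A" using A by (auto simp: mat_kernel_def)
  ultimately show "mat_kernel A = {0\<^sub>v k}" by blast
next
  assume "mat_kernel A = {0\<^sub>v k}"
  then have "has_minor A k" using polynomial_kernel_zero_iff[OF A] by simp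
  then obtain Z d where Z: "Z \<in> carrier_mat k l" and d: "d \<noteq> 0" and ZA: "Z * A = d \<cdot>\<^sub>m 1\<^sub>m k"
    by (rule full_minor_left_inverse[OF A])
  have "d \<cdot>\<^sub>v w \<in> mat_image A\<^sup>T" if w: "w \<in> carrier_vec k" for w
  proof -
    have "A\<^sup>T * Z\<^sup>T = (d \<cdot>\<^sub>m 1\<^sub>m k)\<^sup>T" unfolding ZA[symmetric] by (rule transpose_mult[OF Z A, symmetric])
    also have "\<dots> = d \<cdot>\<^sub>m 1\<^sub>m k" by (rule eq_matI) auto
    finally have "A\<^sup>T *\<^sub>v (Z\<^sup>T *\<^sub>v w) = (d \<cdot>\<^sub>m 1\<^sub>m k) *\<^sub>v w"
      using assoc_mult_mat_vec[of "A\<^sup>T" k l "Z\<^sup>T" k w] A Z w by simp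
    also have "\<dots> = d \<cdot>\<^sub>v w" using w by auto
    finally have "d \<cdot>\<^sub>v w = A\<^sup>T *\<^sub>v (Z\<^sup>T *\<^sub>v w)" ..
    moreover have "Z\<^sup>T *\<^sub>v w \<in> carrier_vec (dim_col A\<^sup>T)" using A Z w by simp
    ultimately show ?thesis unfolding mat_image_def by (rule image_eqI)
  qed
  then show "torsion_module (coker_transpose A)"
    unfolding torsion_coker_transpose_iff using d A by blast
qed

lemma syzygy_matrix_zero_iff:
  fixes A :: "'r::comm_ring_1 mat"
  assumes A: "A \<in> carrier_mat l k" and S: "S \<in> carrier_mat k m" and syz: "syzygy_matrix A S"
  shows "mat_kernel A = {0\<^sub>v k} \<longleftrightarrow> S = 0\<^sub>m k m"
proof -
  interpret vec_module "TYPE('r)" k .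
  have cols: "set (cols S) \<subseteq> carrier_vec k" using S cols_dim by blast
  have ker: "mat_kernel A = span (set (cols S))"
    using syz A by (auto simp: syzygy_matrix_def)
  have sub: "submodule class_ring {0\<^sub>v k} V"
    by (rule submodule.intro) (auto simp: module_vec_simps module_axioms)
  show ?thesis
  proof
    assume "mat_kernel A = {0\<^sub>v k}"
    then have "set (cols S) \<subseteq> {0\<^sub>v k}" using in_own_span[OF cols] ker by simp
    then have "col S j = 0\<^sub>v k" if "j < m" for j
    proof -
      have "col S j \<in> set (cols S)" using that S by (simp add: cols_def)
      then show ?thesis using \<open>set (cols S) \<subseteq> {0\<^sub>v k}\<close> by blast
    qed
    then have "S $$ (i, j) = 0" if "i < k" "j < m" for i j
      using that S by (metis carrier_matD index_col index_zero_vec(1))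
    then show "S = 0\<^sub>m k m" using S by (intro eq_matI) auto
  next
    assume "S = 0\<^sub>m k m"
    then have "set (cols S) \<subseteq> {0\<^sub>v k}" by (auto simp: cols_def)
    then have "mat_kernel A \<subseteq> {0\<^sub>v k}"
      unfolding ker by (rule span_is_subset[OF _ sub])
    moreover have "0\<^sub>v k \<in> mat_kernel A" using A by (auto simp: mat_kernel_def)
    ultimately show "mat_kernel A = {0\<^sub>v k}" by auto
  qed
qed

section \<open>Characterisation of uncontrollability\<close>

theorem corollary3p3:
  fixes A :: "('n::finite, complex) mpoly mat"
    and F :: "(('n, complex) mpoly, 'f) module"
    and l k :: nat
  assumes A: "A \<in> carrier_mat l k"
    and F: "injective_cogenerator F"
  shows
    "(uncontrollable F (module_kernel F A) \<longleftrightarrow> torsion_module (coker_transpose A)) \<and>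
     (torsion_module (coker_transpose A) \<longleftrightarrow> mat_kernel A = {0\<^sub>v k}) \<and>
     (\<forall>m. \<forall>S\<in>carrier_mat k m. syzygy_matrix A S \<longrightarrow>
        (mat_kernel A = {0\<^sub>v k} \<longleftrightarrow> S = 0\<^sub>m k m)) \<and>
     (mat_kernel A = {0\<^sub>v k} \<longleftrightarrow>
        (\<exists>V :: ('n \<Rightarrow> real) set. proper_subvariety V \<and>
           (\<forall>\<xi>. \<xi> \<notin> V \<longrightarrow> mat_kernel (mat_at A (real_point \<xi>)) = {0\<^sub>v k}))) \<and>
     (mat_kernel A = {0\<^sub>v k} \<longleftrightarrow>
        (\<exists>V :: ('n \<Rightarrow> complex) set. proper_subvariety V \<and>
           (\<forall>\<xi>. \<xi> \<notin> V \<longrightarrow> mat_kernel (mat_at A \<xi>) = {0\<^sub>v k}))) \<and>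
     proper_subvariety (real_rank_drop A) \<and> proper_subvariety (complex_rank_drop A) \<and>
     (mat_kernel A = {0\<^sub>v k} \<longrightarrow>
        real_rank_drop A = {\<xi>. mat_kernel (mat_at A (real_point \<xi>)) \<noteq> {0\<^sub>v k}} \<and>
        complex_rank_drop A = {\<xi>. mat_kernel (mat_at A \<xi>) \<noteq> {0\<^sub>v k}})"
proof -
  let ?K = "mat_kernel A = {0\<^sub>v k}"
  have dim: "dim_col A = k" using A by simp
  \<comment> \<open>With zero kernel the generic rank is \<open>k\<close>, and rank \<open>k\<close> at a point means zero kernel there.\<close>
  have complex_rank: "complex_rank_drop A = {\<xi>. mat_kernel (mat_at A \<xi>) \<noteq> {0\<^sub>v k}}"
    and real_rank: "real_rank_drop A = {\<xi>. mat_kernel (mat_at A (real_point \<xi>)) \<noteq> {0\<^sub>v k}}" if ?K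
  proof -
    have "k \<le> generic_rank A" "generic_rank A \<le> k"
      using that polynomial_kernel_zero_iff[OF A] has_minor_le_dim_col[of A "generic_rank A"] dim
      by (auto simp: le_generic_rank_iff[symmetric])
    then have "generic_rank A = k" by simp
    then have "mat_rank (mat_at A \<xi>) \<noteq> generic_rank A \<longleftrightarrow> mat_kernel (mat_at A \<xi>) \<noteq> {0\<^sub>v k}" for \<xi>
      unfolding kernel_mat_at_zero_iff[OF A] rank_drop_iff by (simp add: has_minor_iff_minors minors_mat_at)
    then show "complex_rank_drop A = {\<xi>. mat_kernel (mat_at A \<xi>) \<noteq> {0\<^sub>v k}}"
      "real_rank_drop A = {\<xi>. mat_kernel (mat_at A (real_point \<xi>)) \<noteq> {0\<^sub>v k}}"
      by (simp_all add: complex_rank_drop_def real_rank_drop_def)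
  qed
  have pointwise: ?K if "mat_kernel (mat_at A \<xi>) = {0\<^sub>v k}" for \<xi>
    using that has_minor_mat_at_imp by (simp add: kernel_mat_at_zero_iff[OF A] polynomial_kernel_zero_iff[OF A])
  have real: "?K \<longleftrightarrow> (\<exists>V :: ('n \<Rightarrow> real) set. proper_subvariety V \<and>
      (\<forall>\<xi>. \<xi> \<notin> V \<longrightarrow> mat_kernel (mat_at A (real_point \<xi>)) = {0\<^sub>v k}))"
  proof
    assume ?K
    then show "\<exists>V :: ('n \<Rightarrow> real) set. proper_subvariety V \<and>
        (\<forall>\<xi>. \<xi> \<notin> V \<longrightarrow> mat_kernel (mat_at A (real_point \<xi>)) = {0\<^sub>v k})"
      using proper_subvariety_rank_drop(2)[of A] unfolding real_rank[OF \<open>?K\<close>] by blast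
  next
    assume "\<exists>V :: ('n \<Rightarrow> real) set. proper_subvariety V \<and>
        (\<forall>\<xi>. \<xi> \<notin> V \<longrightarrow> mat_kernel (mat_at A (real_point \<xi>)) = {0\<^sub>v k})"
    then obtain \<xi> where "mat_kernel (mat_at A (real_point \<xi>)) = {0\<^sub>v k}"
      unfolding proper_subvariety_def by blast
    then show ?K by (rule pointwise)
  qed
  have complex: "?K \<longleftrightarrow> (\<exists>V :: ('n \<Rightarrow> complex) set. proper_subvariety V \<and>
      (\<forall>\<xi>. \<xi> \<notin> V \<longrightarrow> mat_kernel (mat_at A \<xi>) = {0\<^sub>v k}))"
  proof
    assume ?K
    then show "\<exists>V :: ('n \<Rightarrow> complex) set. proper_subvariety V \<and>
        (\<forall>\<xi>. \<xi> \<notin> V \<longrightarrow> mat_kernel (mat_at A \<xi>) = {0\<^sub>v k})"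
      using proper_subvariety_rank_drop(1)[of A] unfolding complex_rank[OF \<open>?K\<close>] by blast
  next
    assume "\<exists>V :: ('n \<Rightarrow> complex) set. proper_subvariety V \<and>
        (\<forall>\<xi>. \<xi> \<notin> V \<longrightarrow> mat_kernel (mat_at A \<xi>) = {0\<^sub>v k})"
    then obtain \<xi> where "mat_kernel (mat_at A \<xi>) = {0\<^sub>v k}"
      unfolding proper_subvariety_def by blast
    then show ?K by (rule pointwise)
  qed
  have syz: "\<forall>m. \<forall>S\<in>carrier_mat k m. syzygy_matrix A S \<longrightarrow> (?K \<longleftrightarrow> S = 0\<^sub>m k m)"
    by (intro allI ballI impI syzygy_matrix_zero_iff[OF A])
  show ?thesis
    by (intro conjI impI uncontrollable_iff_torsion[OF F] torsion_iff_kernel_zero[OF A] syz real complex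
        proper_subvariety_rank_drop real_rank complex_rank)
qed

end
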